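(* Let $\mathcal U$ be a quasi-selective ultrafilter on $\mathbb N$ and let $f:\mathbb N\to\mathbb N$ be nondecreasing. Then the following are equivalent: (i) for every function $g:\mathbb N\to\mathbb N$ with $g\le f$ (pointwise) there exists a nondecreasing function $h$ with $h\equiv_{\mathcal U} g$; (ii) there exists a set $U=\{u_n: n\in\mathbb N\}\in\mathcal U$, enumerated increasingly ($u_0<u_1<\cdots$), such that $f(u_n)<u_{n+1}-u_n$ for all $n$.
   Context: $\mathbb N=\{0,1,2,\dots\}$. $f\equiv_{\mathcal U}g$ means $\{n: f(n)=g(n)\}\in\mathcal U$. A nonprincipal ultrafilter $\mathcal U$ on $\mathbb N$ is quasi-selective if every $f:\mathbb N\to\mathbb N$ with $f(n)\le n$ for all $n$ is $\mathcal U$-equivalent to a nondecreasing function. *)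

theory Defs
  imports Main
begin

text \<open>
  Ultrafilters on \<open>'a\<close> are represented by the library type \<open>'a filter\<close>: a set \<open>A\<close> belongs to
  \<open>F\<close> iff \<open>\<forall>\<^sub>F x in F. x \<in> A\<close>.  That type includes the improper filter \<open>bot\<close>, which therefore
  has to be excluded.
\<close>

definition ultrafilter :: "'a filter \<Rightarrow> bool" where
  "ultrafilter F \<longleftrightarrow>
     F \<noteq> bot \<and> (\<forall>A. (\<forall>\<^sub>F x in F. x \<in> A) \<or> (\<forall>\<^sub>F x in F. x \<notin> A))"

definition nonprincipal_ultrafilter :: "'a filter \<Rightarrow> bool" where
  "nonprincipal_ultrafilter F \<longleftrightarrow> ultrafilter F \<and> (\<forall>a. F \<noteq> principal {a})"

definition equiv_mod :: "'a filter \<Rightarrow> ('a \<Rightarrow> 'b) \<Rightarrow> ('a \<Rightarrow> 'b) \<Rightarrow> bool" where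
  "equiv_mod F f g \<longleftrightarrow> (\<forall>\<^sub>F n in F. f n = g n)"

definition quasi_selective :: "nat filter \<Rightarrow> bool" where
  "quasi_selective F \<longleftrightarrow> nonprincipal_ultrafilter F \<and>
     (\<forall>f :: nat \<Rightarrow> nat. (\<forall>n. f n \<le> n) \<longrightarrow> (\<exists>h :: nat \<Rightarrow> nat. mono h \<and> equiv_mod F f h))"

end

theory Submission
  imports Defs "HOL-Library.Infinite_Set"
begin

text \<open>
  For (i) \<open>\<Longrightarrow>\<close> (ii), cut \<open>\<nat>\<close> at \<open>a\<^sub>0 = 0\<close>, \<open>a\<^sub>k\<^sub>+\<^sub>1 = a\<^sub>k + f a\<^sub>k + 1\<close>.  The distance from \<open>x\<close> to the
  right end of its interval is at most \<open>f x\<close> and strictly decreasing on every interval, so a set on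
  which it is nondecreasing meets every interval at most once.  Keeping only the intervals
  of one parity then produces the required gaps.

  For (ii) \<open>\<Longrightarrow>\<close> (i), let \<open>g \<le> f\<close>.  If \<open>g x \<le> x\<close> on a set of the ultrafilter, quasi-selectivity
  applies.  Otherwise \<open>u\<^sub>n < g u\<^sub>n \<le> f u\<^sub>n < u\<^sub>n\<^sub>+\<^sub>1\<close> for almost all \<open>u\<^sub>n\<close>, so \<open>g\<close> is already increasing there.
\<close>

lemma ultrafilter_disj:
  assumes "ultrafilter F"
  shows "(\<forall>\<^sub>F x in F. P x) \<or> (\<forall>\<^sub>F x in F. \<not> P x)"
proof -
  have "(\<forall>\<^sub>F x in F. x \<in> Collect P) \<or> (\<forall>\<^sub>F x in F. x \<notin> Collect P)"
    using assms unfolding ultrafilter_def by blast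
  then show ?thesis by simp
qed

text \<open>An ultrafilter containing some \<open>{a}\<close> would equal
  \<open>principal {a}\<close>, so all complements of singletons belong to \<open>F\<close>.
  Finitely many of them intersect to the complement of a finite \<open>A\<close>, which cannot lie
  in \<open>F\<close> together with \<open>A\<close>.\<close>

lemma nonprincipal_ultrafilter_infinite:
  assumes F: "nonprincipal_ultrafilter F" and A: "\<forall>\<^sub>F x in F. x \<in> A"
  shows "infinite A"
proof
  assume "finite A"
  have uf: "ultrafilter F" and np: "\<And>a. F \<noteq> principal {a}"
    using F by (auto simp: nonprincipal_ultrafilter_def)
  have "\<forall>\<^sub>F x in F. x \<noteq> a" for a
  proof (rule ccontr)
    assume "\<not> (\<forall>\<^sub>F x in F. x \<noteq> a)"
    then have ev: "\<forall>\<^sub>F x in F. x = a"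
      using ultrafilter_disj[OF uf, of "\<lambda>x. x = a"] by blast
    have nb: "F \<noteq> bot" using uf by (simp add: ultrafilter_def)
    have "eventually P F \<longleftrightarrow> P a" for P
    proof
      assume "eventually P F"
      with ev have "\<forall>\<^sub>F x in F. P a" by eventually_elim simp
      then show "P a" using nb by (simp add: eventually_const)
    next
      assume "P a"
      with ev show "eventually P F" by (auto elim: eventually_mono)
    qed
    then have "F = principal {a}" by (simp add: filter_eq_iff eventually_principal)
    with np show False by blast
  qed
  then have "\<forall>\<^sub>F x in F. \<forall>a\<in>A. x \<noteq> a"
    using \<open>finite A\<close> by (intro eventually_ball_finite) auto
  with A have "\<forall>\<^sub>F x in F. False" by eventually_elim blast
  then show False using uf by (simp add: ultrafilter_def eventually_False)
qed

lemma mono_on_extend_nat: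
  fixes g :: "nat \<Rightarrow> nat"
  assumes "mono_on A g"
  shows "\<exists>h. mono h \<and> (\<forall>x\<in>A. h x = g x)"
proof (intro exI conjI ballI)
  \<comment> \<open>The running maximum of \<open>g\<close> along \<open>A\<close>. The inserted 0
    keeps \<open>Max\<close> defined below the first point of \<open>A\<close> and never exceeds a
    value of \<open>g\<close>.\<close>
  let ?h = "\<lambda>n. Max (insert 0 (g ` (A \<inter> {..n})))"
  show "mono ?h" by (intro monoI Max_mono) auto
  show "?h x = g x" if "x \<in> A" for x
    using that assms by (intro Max_eqI) (auto simp: mono_on_def)
qed

lemma interval_index_exists:
  fixes a :: "nat \<Rightarrow> nat"
  assumes "a 0 = 0" and "strict_mono a"
  shows "\<exists>k. a k \<le> x \<and> x < a (Suc k)"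
proof (induction x)
  case 0
  then show ?case using assms strict_monoD[OF assms(2), of 0 1] by (intro exI[of _ 0]) simp
next
  case (Suc x)
  then obtain k where "a k \<le> x" "x < a (Suc k)" by blast
  then show ?case
    using strict_monoD[OF assms(2), of "Suc k" "Suc (Suc k)"]
    by (cases "Suc x < a (Suc k)") (auto intro: exI[of _ k] exI[of _ "Suc k"])
qed

text \<open>Stating the gap for all pairs in \<open>A\<close>, not just neighbours, postpones the
  increasing enumeration to the final theorem.\<close>

lemma monotone_below_imp_gaps:
  fixes F :: "nat filter" and f :: "nat \<Rightarrow> nat"
  assumes F: "ultrafilter F" and f: "mono f"
    and below: "\<And>g. (\<And>n. g n \<le> f n) \<Longrightarrow> \<exists>h :: nat \<Rightarrow> nat. mono h \<and> equiv_mod F h g"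
  shows "\<exists>A. (\<forall>\<^sub>F x in F. x \<in> A) \<and> (\<forall>x\<in>A. \<forall>y\<in>A. x < y \<longrightarrow> x + f x < y)"
proof -
  define a where "a = rec_nat 0 (\<lambda>_ m. m + f m + 1)"
  have a0: "a 0 = 0" and aSuc: "a (Suc k) = a k + f (a k) + 1" for k
    by (simp_all add: a_def)
  have "strict_mono a" by (simp add: strict_mono_Suc_iff aSuc)
  then have amono: "i \<le> j \<Longrightarrow> a i \<le> a j" for i j
    by (simp add: strict_mono_less_eq)
  obtain K where K: "\<And>x. a (K x) \<le> x" "\<And>x. x < a (Suc (K x))"
    using interval_index_exists[OF a0 \<open>strict_mono a\<close>] by metis
  have Kmono: "K x \<le> K y" if "x \<le> y" for x y
    using K(1)[of x] K(2)[of y] that amono[of "Suc (K y)" "K x"] by linarith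
  \<comment> \<open>The last point of the interval of \<open>x\<close> is
    \<open>a (Suc (K x)) - 1\<close>. The distance to it is at most \<open>f (a (K x))\<close>,
    hence at most \<open>f x\<close> because \<open>f\<close> is monotone.\<close>
  define g where "g x = a (Suc (K x)) - 1 - x" for x
  have "g x \<le> f x" for x
    using K(1)[of x] monoD[OF f K(1)[of x]] by (simp add: g_def aSuc)
  then obtain h where h: "mono h" "\<forall>\<^sub>F x in F. h x = g x"
    using below[of g] unfolding equiv_mod_def by blast
  obtain b where b: "\<forall>\<^sub>F x in F. even (K x) = b"
    using ultrafilter_disj[OF F, of "\<lambda>x. even (K x)"] that[of True] that[of False] by auto
  define A where "A = {x. h x = g x \<and> even (K x) = b}"
  have "\<forall>\<^sub>F x in F. x \<in> A"
    using h(2) b by eventually_elim (simp add: A_def)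
  moreover have "x + f x < y" if "x \<in> A" "y \<in> A" "x < y" for x y
  proof -
    have "g x \<le> g y" using that monoD[OF h(1), of x y] by (simp add: A_def)
    then have "K x \<noteq> K y"
      using \<open>x < y\<close> K(2)[of x] K(2)[of y] by (auto simp: g_def)
    then have "K x < K y" using Kmono[of x y] \<open>x < y\<close> by simp
    \<comment> \<open>Neighbouring indices differ in parity, so a full interval separates
      \<open>x\<close> from \<open>y\<close>. Its length is \<open>f (a (Suc (K x))) + 1\<close>,
      which exceeds \<open>f x\<close>.\<close>
    moreover have "K y \<noteq> Suc (K x)" using that by (auto simp: A_def)
    ultimately have "a (Suc (Suc (K x))) \<le> a (K y)" by (intro amono) simp
    moreover have "f x \<le> f (a (Suc (K x)))" using K(2)[of x] by (intro monoD[OF f]) simp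
    ultimately show ?thesis
      using K(2)[of x] K(1)[of y] aSuc[of "Suc (K x)"] by linarith
  qed
  ultimately show ?thesis by blast
qed

lemma gaps_imp_monotone_below:
  fixes F :: "nat filter" and f g :: "nat \<Rightarrow> nat"
  assumes F: "quasi_selective F"
    and A: "\<forall>\<^sub>F x in F. x \<in> A"
    and gap: "\<And>x y. x \<in> A \<Longrightarrow> y \<in> A \<Longrightarrow> x < y \<Longrightarrow> f x < y"
    and g: "\<And>n. g n \<le> f n"
  shows "\<exists>h :: nat \<Rightarrow> nat. mono h \<and> equiv_mod F h g"
proof -
  have "ultrafilter F"
    using F by (simp add: quasi_selective_def nonprincipal_ultrafilter_def)
  from ultrafilter_disj[OF this, of "\<lambda>x. g x \<le> x"] show ?thesis
  proof
    assume le: "\<forall>\<^sub>F x in F. g x \<le> x"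
    \<comment> \<open>Quasi-selectivity requires the bound at every \<open>n\<close>. Truncating by
      \<open>min\<close> provides it and leaves \<open>g\<close> unchanged wherever
      \<open>g n \<le> n\<close>.\<close>
    have "\<exists>h :: nat \<Rightarrow> nat. mono h \<and> equiv_mod F (\<lambda>n. min (g n) n) h"
      using F by (simp add: quasi_selective_def)
    then obtain h :: "nat \<Rightarrow> nat" where h: "mono h" "\<forall>\<^sub>F n in F. min (g n) n = h n"
      unfolding equiv_mod_def by blast
    have "\<forall>\<^sub>F n in F. h n = g n" using le h(2) by eventually_elim simp
    with h(1) show ?thesis unfolding equiv_mod_def by blast
  next
    assume gt: "\<forall>\<^sub>F x in F. \<not> g x \<le> x"
    define B where "B = {x \<in> A. x < g x}"
    have B: "\<forall>\<^sub>F x in F. x \<in> B" using A gt by eventually_elim (simp add: B_def)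
    have "mono_on B g"
    proof (rule mono_onI)
      fix x y assume xy: "x \<in> B" "y \<in> B" "x \<le> y"
      show "g x \<le> g y"
      proof (cases "x = y")
        case False
        then have "f x < y" using xy gap by (simp add: B_def)
        then show ?thesis using g[of x] xy(2) by (simp add: B_def)
      qed simp
    qed
    then obtain h where h: "mono h" "\<And>x. x \<in> B \<Longrightarrow> h x = g x"
      using mono_on_extend_nat by blast
    have "\<forall>\<^sub>F x in F. h x = g x" using B by (rule eventually_mono) (rule h(2))
    with h(1) show ?thesis unfolding equiv_mod_def by blast
  qed
qed

theorem theorem1p4:
  fixes \<U> :: "nat filter" and f :: "nat \<Rightarrow> nat"
  assumes "quasi_selective \<U>" and "mono f"
  shows "(\<forall>g :: nat \<Rightarrow> nat. (\<forall>n. g n \<le> f n) \<longrightarrow> (\<exists>h :: nat \<Rightarrow> nat. mono h \<and> equiv_mod \<U> h g))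
     \<longleftrightarrow> (\<exists>(U :: nat set) (u :: nat \<Rightarrow> nat).
            (\<forall>\<^sub>F x in \<U>. x \<in> U) \<and> U = range u \<and> strict_mono u \<and>
            (\<forall>n. f (u n) < u (Suc n) - u n))"
  (is "?below \<longleftrightarrow> ?gaps")
proof
  assume below: ?below
  have np: "nonprincipal_ultrafilter \<U>" using assms(1) by (simp add: quasi_selective_def)
  then have "ultrafilter \<U>" by (simp add: nonprincipal_ultrafilter_def)
  then obtain A where A: "\<forall>\<^sub>F x in \<U>. x \<in> A"
    and gap: "\<And>x y. x \<in> A \<Longrightarrow> y \<in> A \<Longrightarrow> x < y \<Longrightarrow> x + f x < y"
    using monotone_below_imp_gaps[OF _ assms(2)] below by metis
  \<comment> \<open>Infinitude makes \<open>enumerate A\<close> a strictly increasing sequence with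
    range exactly \<open>A\<close>.\<close>
  have inf: "infinite A" using nonprincipal_ultrafilter_infinite[OF np A] .
  have "f (enumerate A n) < enumerate A (Suc n) - enumerate A n" for n
    using gap[OF enumerate_in_set[OF inf] enumerate_in_set[OF inf] enumerate_step[OF inf], of n]
    by linarith
  with A range_enumerate[OF inf] strict_mono_enumerate[OF inf] show ?gaps
    by (intro exI[of _ A] exI[of _ "enumerate A"]) simp
next
  assume ?gaps
  then obtain u where u: "\<forall>\<^sub>F x in \<U>. x \<in> range u" "strict_mono u"
    and step: "\<And>n. f (u n) < u (Suc n) - u n" by blast
  have "f x < y" if xy: "x \<in> range u" "y \<in> range u" "x < y" for x y
  proof -
    obtain i j where ij: "x = u i" "y = u j" using xy by blast
    then have "u (Suc i) \<le> u j" using xy(3) u(2) by (simp add: strict_mono_less strict_mono_less_eq)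
    then show ?thesis using step[of i] ij by simp
  qed
  then show ?below using gaps_imp_monotone_below[OF assms(1) u(1)] by blast
qed

end
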